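(* Let $\varphi:\mathbb{R}_{\ge 0}\times\Theta\to\Theta$ be the flow of the ODE $\mathrm{d}\theta/\mathrm{d}t=F(\theta)$, i.e. for each $\theta\in\Theta$, $\varphi(\cdot;\theta)$ is absolutely continuous and $\varphi(t;\theta)=\theta+\int_0^t F(\varphi(\tau;\theta))\,\mathrm{d}\tau$ for all $t\ge0$. Let $\Psi:\Theta\to\mathbb{R}_{\ge0}$ be a locally Lipschitz function. 1. If for some $C>0$, $$D^+_{F(\theta)}\Psi(\theta)\le -C\,\Psi(\theta)\qquad(\ast)$$ for all $\theta\in\Theta$, then $\Psi(\varphi(t;\theta))\le e^{-Ct}\,\Psi(\theta)$ for any $\theta\in\Theta$ and any $t\ge0$. 2. Similarly, if for some $C>0$ and some $\zeta>0$ the inequality $(\ast)$ holds for any $\theta\in U=\{\theta\in\Theta:\Psi(\theta)<\zeta\}$, then $\Psi(\varphi(t;\theta))\le e^{-Ct}\,\Psi(\theta)$ for any $\theta\in U$ and any $t\ge0$. 3. Moreover, if there exists $C>0$ such that $$D^-_{F(\theta)}\Psi(\theta)\ge -C\,\Psi(\theta)$$ for any $\theta\in\Theta$, then $\Psi(\varphi(t;\theta))\ge e^{-Ct}\,\Psi(\theta)$ for any $\theta\in\Theta$ and any $t\ge0$.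
   Context: $\Theta\subseteq\mathbb{R}^{D}$ for a positive integer $D$, and $F:\Theta\to\mathbb{R}^{D}$ is a vector field (the mean field of a stochastic algorithm). The upper and lower Dini directional derivatives of $\Psi$ at $\theta$ in the direction $v$ are $$D^+_{v}\Psi(\theta)=\limsup_{h\downarrow0}\frac{\Psi(\theta+hv)-\Psi(\theta)}{h},\qquad D^-_{v}\Psi(\theta)=\liminf_{h\downarrow0}\frac{\Psi(\theta+hv)-\Psi(\theta)}{h},$$ assumed to be well defined (i.e. $\theta+hv\in\Theta$ for all small $h>0$). *)

theory Defs
  imports "HOL-Analysis.Analysis"
begin

definition absolutely_continuous_on :: "real set \<Rightarrow> (real \<Rightarrow> 'a::real_normed_vector) \<Rightarrow> bool" where
  "absolutely_continuous_on S f \<longleftrightarrow>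
    (\<forall>e>0. \<exists>d>0. \<forall>(n::nat) a b.
      (\<forall>i<n. a i \<le> b i \<and> {a i..b i} \<subseteq> S) \<longrightarrow>
      disjoint_family_on (\<lambda>i. {a i<..<b i}) {..<n} \<longrightarrow>
      (\<Sum>i<n. b i - a i) < d \<longrightarrow>
      (\<Sum>i<n. norm (f (b i) - f (a i))) < e)"

(* Absolute continuity on the unbounded time axis [0,\<infinity>) is understood, as usual for ODE
   solutions, on every compact interval [0,T].  The integral is the Lebesgue integral; its
   existence is stated explicitly, since the library integral of a non-integrable function is 0. *)
definition flow_of :: "(real^'n) set \<Rightarrow> (real^'n \<Rightarrow> real^'n) \<Rightarrow> (real \<Rightarrow> real^'n \<Rightarrow> real^'n) \<Rightarrow> bool" where
  "flow_of \<Theta> F \<phi> \<longleftrightarrow>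
    (\<forall>\<theta>\<in>\<Theta>.
      (\<forall>t\<ge>0. \<phi> t \<theta> \<in> \<Theta>) \<and>
      (\<forall>T\<ge>0. absolutely_continuous_on {0..T} (\<lambda>t. \<phi> t \<theta>)) \<and>
      (\<forall>t\<ge>0. set_integrable lebesgue {0..t} (\<lambda>\<tau>. F (\<phi> \<tau> \<theta>)) \<and>
              \<phi> t \<theta> = \<theta> + (LINT \<tau>:{0..t}|lebesgue. F (\<phi> \<tau> \<theta>))))"

definition locally_lipschitz_on :: "'a::metric_space set \<Rightarrow> ('a \<Rightarrow> 'b::metric_space) \<Rightarrow> bool" where
  "locally_lipschitz_on X f \<longleftrightarrow> (\<forall>x\<in>X. \<exists>u>0. \<exists>L. L-lipschitz_on (cball x u \<inter> X) f)"

lemma locally_lipschitz_on_iff_local_lipschitz: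
  "locally_lipschitz_on X f \<longleftrightarrow> local_lipschitz (UNIV :: real set) X (\<lambda>_. f)"
proof -
  have "(\<forall>t'\<in>cball t u \<inter> UNIV. L-lipschitz_on A f) \<longleftrightarrow> L-lipschitz_on A f"
    if "u > 0" for t u :: real and L A
    using that by (auto intro: exI[of _ t])
  then show ?thesis
    unfolding locally_lipschitz_on_def local_lipschitz_def
    by (metis UNIV_I)
qed

(* The functions below are total, so a Dini derivative of a function on \<Theta> is meaningful only
   together with "admissible_direction", which says that the difference quotients are
   eventually formed inside \<Theta>; the values outside \<Theta> are then irrelevant. *)
definition admissible_direction :: "'a::real_normed_vector set \<Rightarrow> 'a \<Rightarrow> 'a \<Rightarrow> bool" where
  "admissible_direction \<Theta> \<theta> v \<longleftrightarrow> (\<forall>\<^sub>F h in at_right (0::real). \<theta> + h *\<^sub>R v \<in> \<Theta>)"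

definition upper_dini :: "('a::real_normed_vector \<Rightarrow> real) \<Rightarrow> 'a \<Rightarrow> 'a \<Rightarrow> ereal" where
  "upper_dini \<Psi> \<theta> v = Limsup (at_right (0::real)) (\<lambda>h. ereal ((\<Psi> (\<theta> + h *\<^sub>R v) - \<Psi> \<theta>) / h))"

definition lower_dini :: "('a::real_normed_vector \<Rightarrow> real) \<Rightarrow> 'a \<Rightarrow> 'a \<Rightarrow> ereal" where
  "lower_dini \<Psi> \<theta> v = Liminf (at_right (0::real)) (\<lambda>h. ereal ((\<Psi> (\<theta> + h *\<^sub>R v) - \<Psi> \<theta>) / h))"

end

theory Submission
  imports Defs
begin

text \<open>
  Write \<open>X t\<close> for the trajectory \<open>\<phi> t \<theta>\<close>. The claim is that \<open>g t = exp (C * t) * \<Psi> (X t)\<close> never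
  exceeds \<open>g 0\<close>. As \<open>\<Psi>\<close> is locally Lipschitz, the increment of \<open>\<Psi>\<close> over a short time \<open>h\<close> along
  the trajectory differs from its increment along the straight segment \<open>h *\<^sub>R F (X t)\<close>, which the
  Dini derivative controls, by at most a constant times the linearization error
  \<open>norm (X (t + h) - X t - h *\<^sub>R F (X t))\<close>. If the trajectory were differentiable everywhere, this
  error would be \<open>o(h)\<close>; as \<open>F\<close> is merely integrable along the trajectory, it is so only for
  almost every \<open>t\<close>.

  Instead of going through almost everywhere differentiability, the proof works at every \<open>t\<close> and
  shows that the linearization errors have a small total. By Henstock's lemma, for a suitable gauge
  the errors summed over any fine tagged family of non-overlapping intervals are below a prescribed
  \<open>e\<close>. The supremum of these sums over the families inside \<open>{a..t}\<close> is a monotone function \<open>W t\<close>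
  that grows by at most \<open>e\<close> in total and yet, to the right of each \<open>t\<close>, grows at least as fast as
  the linearization error (\<open>monotone_linearization_majorant\<close>). Hence \<open>g\<close> cannot, immediately to the
  right of any \<open>t\<close>, grow faster than the monotone function \<open>\<epsilon> * t + K * W t\<close>, and a continuous
  induction (\<open>continuous_induction_diff_le\<close>) makes this a bound on the whole interval. Letting \<open>\<epsilon>\<close>
  and \<open>e\<close> tend to zero gives \<open>g t \<le> g 0\<close>.

  The Dini inequality is used only at times with \<open>g t < \<zeta>\<close>, and the induction itself keeps \<open>g\<close>
  below any \<open>\<zeta> > g 0\<close>. Because \<open>0 \<le> \<Psi>\<close> and \<open>C > 0\<close> give \<open>\<Psi> (X t) \<le> g t\<close>, this covers a Dini
  inequality that is only known on a sublevel set of \<open>\<Psi>\<close>, and the global upper bound is the case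
  of a sublevel set that contains \<open>\<theta>\<close>. The lower bound is the upper bound for \<open>- \<Psi>\<close>; for this
  reason the general lemmas let \<open>\<Psi>\<close> and \<open>C\<close> have any sign.
\<close>

section \<open>Growth bounds from infinitesimal steps to the right\<close>

text \<open>
  The monotone function \<open>H\<close> may jump. Continuity of \<open>g\<close> carries the bound to the left limit of the
  times reached so far, where a jump of \<open>H\<close> can only help; \<open>step\<close> then carries it beyond. The
  hypothesis \<open>step\<close> is restricted to times that already satisfy the bound, so that a descent
  property valid only below some threshold can be fed in.
\<close>
lemma continuous_induction_diff_le:
  fixes g H :: "real \<Rightarrow> real"
  assumes ab: "a \<le> b" and g: "continuous_on {a..b} g" and H: "mono_on {a..b} H"
    and step: "\<And>t. a \<le> t \<Longrightarrow> t < b \<Longrightarrow> g t - H t \<le> g a - H a \<Longrightarrow>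
      \<forall>\<^sub>F h in at_right 0. g (t + h) - H (t + h) \<le> g t - H t"
  shows "g b - H b \<le> g a - H a"
proof -
  define S where "S = {t\<in>{a..b}. \<forall>s\<in>{a..t}. g s - H s \<le> g a - H a}"
  define \<tau> where "\<tau> = Sup S"
  have aS: "a \<in> S" using ab by (auto simp: S_def)
  have bdd: "bdd_above S" by (auto simp: S_def bdd_above_def)
  have \<tau>: "a \<le> \<tau>" "\<tau> \<le> b"
    using aS bdd by (auto simp: \<tau>_def S_def intro!: cSup_upper cSup_least)
  have below: "g s - H s \<le> g a - H a" if s: "a \<le> s" "s < \<tau>" for s
  proof -
    obtain t where "t \<in> S" "s < t" using s(2) aS bdd less_cSup_iff[of S s] by (auto simp: \<tau>_def)
    then show ?thesis using s by (auto simp: S_def)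
  qed
  have at_\<tau>: "g \<tau> - H \<tau> \<le> g a - H a"
  proof (cases "a = \<tau>")
    case False
    then have lt: "a < \<tau>" using \<tau> by simp
    have "continuous_on {a..\<tau>} g" using g \<tau> by (auto intro: continuous_on_subset)
    then have "(g \<longlongrightarrow> g \<tau>) (at_left \<tau>)"
      using lt continuous_on_Icc_at_leftD by blast
    moreover have "\<forall>\<^sub>F s in at_left \<tau>. g s \<le> g a - H a + H \<tau>"
      unfolding eventually_at_left[OF lt]
    proof (intro exI[of _ a] conjI lt allI impI)
      fix s assume s: "a < s" "s < \<tau>"
      have "H s \<le> H \<tau>" using s \<tau> by (intro mono_onD[OF H]) auto
      then show "g s \<le> g a - H a + H \<tau>" using below[of s] s by simp
    qed
    ultimately have "g \<tau> \<le> g a - H a + H \<tau>"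
      by (intro tendsto_upperbound) (auto simp: trivial_limit_at_left_real)
    then show ?thesis by simp
  qed simp
  have "\<tau> = b"
  proof (rule ccontr)
    assume "\<tau> \<noteq> b"
    then have lt: "\<tau> < b" using \<tau> by simp
    obtain d where d: "d > 0" "\<And>h. 0 < h \<Longrightarrow> h < d \<Longrightarrow> g (\<tau> + h) - H (\<tau> + h) \<le> g \<tau> - H \<tau>"
      using step[OF \<tau>(1) lt at_\<tau>] by (auto simp: eventually_at_right_field)
    define r where "r = min b (\<tau> + d / 2)"
    have "g s - H s \<le> g a - H a" if "a \<le> s" "s \<le> r" for s
    proof (cases "s \<le> \<tau>")
      case True then show ?thesis using below at_\<tau> that by (cases "s = \<tau>") auto
    next
      case False
      then have "0 < s - \<tau>" "s - \<tau> < d" using that d(1) by (auto simp: r_def)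
      from d(2)[OF this] at_\<tau> show ?thesis by simp
    qed
    then have "r \<in> S" using \<tau> lt d by (auto simp: S_def r_def)
    then have "r \<le> \<tau>" using bdd by (auto simp: \<tau>_def intro: cSup_upper)
    then show False using lt d by (auto simp: r_def min_def split: if_splits)
  qed
  then show ?thesis using at_\<tau> by simp
qed

text \<open>
  A substitute for the almost everywhere differentiability of the indefinite integral that holds at
  every point: the function \<open>W\<close> collects the errors of all fine tagged partial divisions of \<open>{a..t}\<close>,
  whose sums Henstock's lemma bounds uniformly. Any such division of \<open>{a..t}\<close> can be extended by
  the interval \<open>{t..t + h}\<close> tagged at its left end, provided that \<open>h\<close> is small for the gauge at \<open>t\<close>,
  which is why \<open>W\<close> increases by at least the error of that interval.
\<close>
lemma monotone_linearization_majorant: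
  fixes f :: "real \<Rightarrow> 'a::euclidean_space"
  assumes ab: "a \<le> b" and f: "f integrable_on {a..b}" and e: "e > 0"
  obtains W :: "real \<Rightarrow> real" where "mono_on {a..b} W" and "W b - W a \<le> e"
    and "\<And>t. a \<le> t \<Longrightarrow> t < b \<Longrightarrow>
      \<forall>\<^sub>F h in at_right 0. norm (integral {t..t + h} f - h *\<^sub>R f t) \<le> W (t + h) - W t"
proof -
  define err where "err = (\<lambda>(x, k). norm (measure lborel k *\<^sub>R f x - integral k f))"
  obtain \<gamma> where \<gamma>: "gauge \<gamma>"
    and hen: "\<And>p. p tagged_partial_division_of {a..b} \<Longrightarrow> \<gamma> fine p \<Longrightarrow> sum err p < e"
    using Henstock_lemma[of f a b e] f e unfolding err_def by auto
  define P where "P t = {p. p tagged_partial_division_of {a..t} \<and> \<gamma> fine p}" for t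
  define W where "W t = Sup (sum err ` P t)" for t
  have empty: "{} \<in> P t" for t by (auto simp: P_def tagged_partial_division_of_def fine_def)
  have sub: "P s \<subseteq> P t" if "s \<le> t" for s t
    using that unfolding P_def tagged_partial_division_of_def by fastforce
  have less_e: "sum err p < e" if "p \<in> P t" "t \<le> b" for p t
    using sub[OF that(2)] that hen by (auto simp: P_def)
  have bdd: "bdd_above (sum err ` P t)" if "t \<le> b" for t
    using less_e[OF _ that] by (auto simp: bdd_above_def intro!: exI[of _ e] less_imp_le)
  have nonempty: "P t \<noteq> {}" for t using empty by blast
  have mono: "mono_on {a..b} W"
    unfolding W_def using sub bdd nonempty
    by (intro mono_onI cSup_subset_mono image_mono) auto
  have nonneg: "0 \<le> W a"
    unfolding W_def using empty[of a] bdd[OF ab] by (intro cSup_upper) (auto intro!: image_eqI[of _ _ "{}"])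
  have le_e: "W b \<le> e"
    unfolding W_def using less_e empty by (intro cSup_least) (auto intro: less_imp_le)
  have step: "\<forall>\<^sub>F h in at_right 0. norm (integral {t..t + h} f - h *\<^sub>R f t) \<le> W (t + h) - W t"
    if t: "a \<le> t" "t < b" for t
  proof -
    obtain d where d: "d > 0" "ball t d \<subseteq> \<gamma> t"
      using \<gamma> by (meson gauge_def openE)
    have "norm (integral {t..t + h} f - h *\<^sub>R f t) \<le> W (t + h) - W t"
      if h: "0 < h" "h < min d (b - t)" for h
    proof -
      let ?k = "(t, {t..t + h})"
      have "sum err p + err ?k \<le> W (t + h)" if p: "p \<in> P t" for p
      proof -
        have fin: "finite p" and pt: "\<And>x k. (x, k) \<in> p \<Longrightarrow> k \<subseteq> {a..t}"
          using p by (auto simp: P_def dest: tagged_partial_division_ofD)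
        have new: "?k \<notin> p" using pt[of t "{t..t + h}"] h by auto
        have disj: "interior k \<inter> interior {t..t + h} = {}" if "(x, k) \<in> p" for x k
          using pt[OF that] interior_subset[of k] by (fastforce simp: interior_atLeastAtMost_real)
        have "insert ?k p tagged_partial_division_of {a..t + h}"
          unfolding tagged_partial_division_of_def
        proof (intro conjI allI impI)
          show "finite (insert ?k p)" using fin by simp
        next
          fix x k assume *: "(x, k) \<in> insert ?k p"
          show "x \<in> k" using * p h by (auto simp: P_def dest: tagged_partial_division_ofD)
          show "k \<subseteq> {a..t + h}" using * pt[of x k] h t by fastforce
          show "\<exists>a b. k = cbox a b"
            using * p unfolding P_def
            by (auto dest: tagged_partial_division_ofD simp flip: box_real)
        next
          fix x1 K1 x2 K2
          assume *: "(x1, K1) \<in> insert ?k p \<and> (x2, K2) \<in> insert ?k p \<and> (x1, K1) \<noteq> (x2, K2)"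
          have "interior K1 \<inter> interior K2 = {}" if "(x1, K1) \<in> p" "(x2, K2) \<in> p"
            using p * that tagged_partial_division_ofD(5) unfolding P_def by blast
          then show "interior K1 \<inter> interior K2 = {}"
            using * disj by blast
        qed
        moreover have "\<gamma> fine insert ?k p"
          using p d(2) h by (auto simp: P_def fine_def dist_real_def subset_eq)
        ultimately have "insert ?k p \<in> P (t + h)" by (simp add: P_def)
        then have "sum err (insert ?k p) \<le> W (t + h)"
          unfolding W_def using bdd[of "t + h"] h by (intro cSup_upper) auto
        then show ?thesis using fin new by simp
      qed
      then have "W t \<le> W (t + h) - err ?k"
        unfolding W_def[of t] using empty
        by (intro cSup_least) (auto simp: algebra_simps)
      then show ?thesis using h by (simp add: err_def norm_minus_commute)
    qed
    then show ?thesis using d(1) t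
      by (auto simp: eventually_at_right_field intro!: exI[of _ "min d (b - t)"])
  qed
  show ?thesis using that[OF mono _ step] nonneg le_e by auto
qed

text \<open>
  The linearization error is allowed in the growth of \<open>g\<close> with any fixed factor \<open>K\<close>, since its
  majorant \<open>W\<close> can be chosen with total growth as small as desired, in particular small against
  \<open>1 / K\<close> and against the gap between \<open>g a\<close> and the threshold \<open>\<zeta>\<close>.
\<close>
lemma approximate_descent_imp_le:
  fixes f :: "real \<Rightarrow> 'a::euclidean_space" and g :: "real \<Rightarrow> real"
  assumes ab: "a \<le> b" and f: "f integrable_on {a..b}" and g: "continuous_on {a..b} g"
    and K: "K \<ge> 0" and \<zeta>: "g a < \<zeta>"
    and descent: "\<And>t \<epsilon>. a \<le> t \<Longrightarrow> t < b \<Longrightarrow> g t < \<zeta> \<Longrightarrow> \<epsilon> > 0 \<Longrightarrow>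
      \<forall>\<^sub>F h in at_right 0. g (t + h) - g t \<le> K * norm (integral {t..t + h} f - h *\<^sub>R f t) + \<epsilon> * h"
  shows "g b \<le> g a"
proof -
  have bound: "g b \<le> g a + \<delta>" if \<delta>: "0 < \<delta>" "\<delta> < \<zeta> - g a" for \<delta>
  proof -
    \<comment> \<open>The budget \<open>\<delta>\<close> is split evenly between the drift \<open>\<epsilon> * t\<close> and the linearization error;
        the \<open>+ 1\<close> in both denominators only keeps them positive.\<close>
    define \<epsilon> where "\<epsilon> = \<delta> / (2 * (b - a + 1))"
    have \<epsilon>: "\<epsilon> > 0" "\<epsilon> * (b - a) \<le> \<delta> / 2" using \<delta> ab by (auto simp: \<epsilon>_def field_simps)
    define e where "e = \<delta> / (2 * (K + 1))"
    have e: "e > 0" "K * e \<le> \<delta> / 2" using \<delta> K by (auto simp: e_def field_simps)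
    obtain W where W: "mono_on {a..b} W" "W b - W a \<le> e"
      and majorant: "\<And>t. a \<le> t \<Longrightarrow> t < b \<Longrightarrow>
        \<forall>\<^sub>F h in at_right 0. norm (integral {t..t + h} f - h *\<^sub>R f t) \<le> W (t + h) - W t"
      using monotone_linearization_majorant[OF ab f e(1)] by blast
    define H where "H t = \<epsilon> * t + K * W t" for t
    have H: "mono_on {a..b} H"
      using \<epsilon>(1) K W(1) unfolding H_def
      by (intro mono_onI add_mono mult_left_mono) (auto intro: mono_onD[OF W(1)])
    have "K * (W b - W a) \<le> K * e" using K W(2) by (intro mult_left_mono)
    then have total: "H b - H a \<le> \<delta>" using \<epsilon>(2) e(2) by (simp add: H_def algebra_simps)
    have "g b - H b \<le> g a - H a"
    proof (rule continuous_induction_diff_le[OF ab g H])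
      fix t assume t: "a \<le> t" "t < b" and le: "g t - H t \<le> g a - H a"
      have "H t \<le> H b" using t by (intro mono_onD[OF H]) auto
      then have "g t < \<zeta>" using le total \<delta>(2) by simp
      from descent[OF t this \<epsilon>(1)] majorant[OF t]
      show "\<forall>\<^sub>F h in at_right 0. g (t + h) - H (t + h) \<le> g t - H t"
      proof eventually_elim
        case (elim h)
        have "K * norm (integral {t..t + h} f - h *\<^sub>R f t) \<le> K * (W (t + h) - W t)"
          using elim(2) K by (rule mult_left_mono)
        then show ?case using elim(1) by (simp add: H_def algebra_simps)
      qed
    qed
    then show ?thesis using total by simp
  qed
  show ?thesis
  proof (rule ccontr)
    assume "\<not> g b \<le> g a"
    then obtain \<delta> where "0 < \<delta>" "\<delta> < \<zeta> - g a" "\<delta> < g b - g a"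
      using \<zeta> dense[of 0 "min (\<zeta> - g a) (g b - g a)"] by auto
    then show False using bound[of \<delta>] by simp
  qed
qed

section \<open>Lipschitz constants and Dini derivatives\<close>

text \<open>
  A Lipschitz constant of \<open>f\<close> on \<open>K\<close> itself would not be enough: the Dini derivative at a point of
  the trajectory evaluates \<open>\<Psi>\<close> on straight segments, which leave the trajectory. So the constant is
  uniform along \<open>K\<close> but valid on neighbourhoods relative to \<open>X\<close>.
\<close>
lemma locally_lipschitz_on_uniform_constant:
  assumes lip: "locally_lipschitz_on X f" and K: "compact K" "K \<subseteq> X"
  obtains L where "L \<ge> 0" "\<And>x. x \<in> K \<Longrightarrow> \<exists>u>0. L-lipschitz_on (cball x u \<inter> X) f"
proof -
  obtain u L where uL: "\<And>x. x \<in> K \<Longrightarrow> u x > 0 \<and> (L x)-lipschitz_on (cball x (u x) \<inter> X) f"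
    using lip K(2) unfolding locally_lipschitz_on_def by (metis subsetD)
  obtain D where D: "D \<subseteq> K" "finite D" "K \<subseteq> (\<Union>x\<in>D. ball x (u x))"
    by (rule compactE_image[OF K(1), of K "\<lambda>x. ball x (u x)"]) (use uL in force)+
  define M where "M = Max (insert 0 (L ` D))"
  have M: "M \<ge> 0" "\<And>x. x \<in> D \<Longrightarrow> L x \<le> M" using D(2) by (auto simp: M_def)
  have "\<exists>w>0. M-lipschitz_on (cball y w \<inter> X) f" if y: "y \<in> K" for y
  proof -
    obtain x where x: "x \<in> D" "y \<in> ball x (u x)" using D(3) y by blast
    obtain w where w: "w > 0" "cball y w \<subseteq> ball x (u x)"
      using x(2) open_contains_cball open_ball by blast
    have "M-lipschitz_on (cball x (u x) \<inter> X) f"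
      using uL x(1) D(1) M(2) by (meson lipschitz_on_le subsetD)
    then have "M-lipschitz_on (cball y w \<inter> X) f"
      by (rule lipschitz_on_subset) (use w(2) in force)
    then show ?thesis using w(1) by blast
  qed
  then show ?thesis using that M(1) by blast
qed

lemma upper_dini_le_imp_eventually_le:
  assumes "upper_dini \<Psi> x v \<le> ereal c" "\<epsilon> > 0"
  shows "\<forall>\<^sub>F h in at_right 0. \<Psi> (x + h *\<^sub>R v) - \<Psi> x \<le> (c + \<epsilon>) * h"
proof -
  have "upper_dini \<Psi> x v < ereal (c + \<epsilon>)"
    using assms by (intro le_less_trans[OF assms(1)]) simp
  then have "\<forall>\<^sub>F h in at_right 0. ereal ((\<Psi> (x + h *\<^sub>R v) - \<Psi> x) / h) < ereal (c + \<epsilon>)"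
    unfolding upper_dini_def by (rule Limsup_lessD)
  then show ?thesis
    using eventually_at_right_less[of 0]
    by eventually_elim (simp add: field_simps)
qed

lemma upper_dini_uminus: "upper_dini (\<lambda>x. - \<Psi> x) x v = - lower_dini \<Psi> x v"
proof -
  have "ereal ((- \<Psi> (x + h *\<^sub>R v) - - \<Psi> x) / h) = - ereal ((\<Psi> (x + h *\<^sub>R v) - \<Psi> x) / h)" for h
    by (simp add: field_simps diff_divide_distrib)
  then show ?thesis
    unfolding upper_dini_def lower_dini_def by (simp only: ereal_Limsup_uminus)
qed

section \<open>Exponential decay along a trajectory\<close>

text \<open>
  In the difference \<open>g (t + h) - g t\<close> of \<open>g t = exp (C * t) * \<Psi> (X t)\<close>, the change of \<open>\<Psi>\<close> contributes
  \<open>- exp (C * (t + h)) * C * \<Psi> (X t) * h\<close> up to small errors, by the Dini inequality, and the change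
  of the exponential contributes \<open>exp (C * t) * C * \<Psi> (X t) * h\<close> up to \<open>o(h)\<close>. They cancel, so
  what remains is the linearization error plus an arbitrarily small multiple of \<open>h\<close>.
\<close>
lemma exp_weighted_decay_along_integral_curve:
  fixes X :: "real \<Rightarrow> 'a::euclidean_space" and f :: "real \<Rightarrow> 'a" and \<Psi> :: "'a \<Rightarrow> real"
  assumes lip: "locally_lipschitz_on \<Theta> \<Psi>"
    and T: "0 \<le> T" and f: "f integrable_on {0..T}"
    and X: "\<And>t. 0 \<le> t \<Longrightarrow> t \<le> T \<Longrightarrow> X t \<in> \<Theta>"
    and X_eq: "\<And>t. 0 \<le> t \<Longrightarrow> t \<le> T \<Longrightarrow> X t = X 0 + integral {0..t} f"
    and \<zeta>: "\<Psi> (X 0) < \<zeta>"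
    and dini: "\<And>t. 0 \<le> t \<Longrightarrow> t < T \<Longrightarrow> exp (C * t) * \<Psi> (X t) < \<zeta> \<Longrightarrow>
      admissible_direction \<Theta> (X t) (f t) \<and> upper_dini \<Psi> (X t) (f t) \<le> ereal (- C * \<Psi> (X t))"
  shows "exp (C * T) * \<Psi> (X T) \<le> \<Psi> (X 0)"
proof -
  have contX: "continuous_on {0..T} X"
  proof (subst continuous_on_cong[OF refl X_eq])
    show "continuous_on {0..T} (\<lambda>t. X 0 + integral {0..t} f)"
      by (intro continuous_intros indefinite_integral_continuous_1 f)
  qed auto
  have cont\<Psi>: "continuous_on \<Theta> \<Psi>"
    using lip local_lipschitz_continuous_on[of "UNIV :: real set" \<Theta> "\<lambda>_. \<Psi>" 0]
    by (simp add: locally_lipschitz_on_iff_local_lipschitz)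
  have "X ` {0..T} \<subseteq> \<Theta>" using X by auto
  then obtain L where L: "L \<ge> 0"
    and nbhd: "\<And>x. x \<in> X ` {0..T} \<Longrightarrow> \<exists>u>0. L-lipschitz_on (cball x u \<inter> \<Theta>) \<Psi>"
    using locally_lipschitz_on_uniform_constant[OF lip compact_continuous_image[OF contX compact_Icc]]
    by blast
  define g where "g t = exp (C * t) * \<Psi> (X t)" for t
  \<comment> \<open>An upper bound of \<open>exp (C * t)\<close> on \<open>{0..T}\<close> for either sign of \<open>C\<close>.\<close>
  define E where "E = exp (\<bar>C\<bar> * T)"
  have "g T \<le> g 0"
  proof (rule approximate_descent_imp_le[OF T f, where K = "E * L" and \<zeta> = \<zeta>])
    have "continuous_on {0..T} (\<lambda>t. \<Psi> (X t))"
      using X by (intro continuous_on_compose2[OF cont\<Psi> contX]) auto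
    then show "continuous_on {0..T} g" unfolding g_def by (intro continuous_intros)
    show "0 \<le> E * L" using L by (simp add: E_def)
    show "g 0 < \<zeta>" using \<zeta> by (simp add: g_def)
    fix t \<epsilon> :: real assume t: "0 \<le> t" "t < T" and "g t < \<zeta>" and \<epsilon>: "\<epsilon> > 0"
    then have adm: "\<forall>\<^sub>F h in at_right 0. X t + h *\<^sub>R f t \<in> \<Theta>"
      and ud: "upper_dini \<Psi> (X t) (f t) \<le> ereal (- C * \<Psi> (X t))"
      using dini[OF t] by (auto simp: g_def admissible_direction_def)
    define \<eta> where "\<eta> = \<epsilon> / (2 * E)"
    have E: "E > 0" by (simp add: E_def)
    have \<eta>: "\<eta> > 0" "\<eta> * E = \<epsilon> / 2" using \<epsilon> E by (auto simp: \<eta>_def)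
    obtain u where u: "u > 0" "L-lipschitz_on (cball (X t) u \<inter> \<Theta>) \<Psi>"
      using nbhd[of "X t"] t by auto
    have shift: "((\<lambda>h. t + h) \<longlongrightarrow> t) (at_right 0)" by (auto intro!: tendsto_eq_intros)
    have inT: "\<forall>\<^sub>F h in at_right 0. 0 < h \<and> t + h \<le> T"
      using t by (auto simp: eventually_at_right_field intro!: exI[of _ "T - t"])
    have "((\<lambda>h. X (t + h)) \<longlongrightarrow> X t) (at_right 0)"
      by (rule continuous_on_tendsto_compose[OF contX shift]) (use t inT in \<open>auto elim: eventually_mono\<close>)
    then have nearX: "\<forall>\<^sub>F h in at_right 0. dist (X (t + h)) (X t) < u"
      using u(1) by (rule tendstoD)
    have "((\<lambda>h. X t + h *\<^sub>R f t) \<longlongrightarrow> X t) (at_right 0)" by (auto intro!: tendsto_eq_intros)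
    then have nearL: "\<forall>\<^sub>F h in at_right 0. dist (X t + h *\<^sub>R f t) (X t) < u"
      using u(1) by (rule tendstoD)
    \<comment> \<open>With \<open>X t\<close> kept fixed, the growth of the exponential factor is compensated by the decay
        rate \<open>C\<close> in the Dini inequality, to first order in \<open>h\<close>.\<close>
    have "((\<lambda>s. exp (C * s) * \<Psi> (X t)) has_real_derivative (C * exp (C * t)) * \<Psi> (X t)) (at t)"
      by (auto intro!: derivative_eq_intros)
    then have "((\<lambda>h. (exp (C * (t + h)) * \<Psi> (X t) - exp (C * t) * \<Psi> (X t)) / h
        - exp (C * (t + h)) * (C * \<Psi> (X t))) \<longlongrightarrow> (C * exp (C * t)) * \<Psi> (X t) - exp (C * t) * (C * \<Psi> (X t))) (at_right 0)"
      unfolding DERIV_def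
      by (intro tendsto_intros shift) (auto intro: filterlim_mono at_le)
    then have "\<forall>\<^sub>F h in at_right 0. (exp (C * (t + h)) * \<Psi> (X t) - exp (C * t) * \<Psi> (X t)) / h
        - exp (C * (t + h)) * (C * \<Psi> (X t)) < \<epsilon> / 2"
      using \<epsilon> by (intro order_tendstoD(2)) (auto simp: algebra_simps)
    with adm inT nearX nearL upper_dini_le_imp_eventually_le[OF ud \<eta>(1)]
    show "\<forall>\<^sub>F h in at_right 0. g (t + h) - g t
      \<le> (E * L) * norm (integral {t..t + h} f - h *\<^sub>R f t) + \<epsilon> * h"
    proof eventually_elim
      case (elim h)
      define N where "N = norm (integral {t..t + h} f - h *\<^sub>R f t)"
      define w where "w = exp (C * (t + h))"
      have h: "0 < h" "t + h \<le> T" using elim by auto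
      have "C * (t + h) \<le> \<bar>C\<bar> * T" using h t by (intro mult_mono) auto
      then have w: "0 < w" "w \<le> E" by (auto simp: w_def E_def)
      have "integral {0..t} f + integral {t..t + h} f = integral {0..t + h} f"
        using t h f by (intro Henstock_Kurzweil_Integration.integral_combine) (auto intro: integrable_on_subinterval)
      then have XX: "X (t + h) - X t = integral {t..t + h} f"
        using X_eq[of t] X_eq[of "t + h"] t h by (simp add: diff_eq_eq add.commute)
      have "\<bar>\<Psi> (X (t + h)) - \<Psi> (X t + h *\<^sub>R f t)\<bar> \<le> L * dist (X (t + h)) (X t + h *\<^sub>R f t)"
        using lipschitz_onD[OF u(2), of "X (t + h)" "X t + h *\<^sub>R f t"] elim X[of "t + h"] t h
        by (auto simp: dist_real_def dist_commute)
      also have "dist (X (t + h)) (X t + h *\<^sub>R f t) = N"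
        unfolding dist_norm N_def XX[symmetric] by (simp add: algebra_simps)
      finally have "\<Psi> (X (t + h)) - \<Psi> (X t) \<le> L * N + (- C * \<Psi> (X t) + \<eta>) * h"
        using elim by simp
      then have "w * (\<Psi> (X (t + h)) - \<Psi> (X t)) \<le> w * (L * N + (- C * \<Psi> (X t) + \<eta>) * h)"
        using w(1) by (intro mult_left_mono) auto
      moreover have "w * (L * N) \<le> E * (L * N)" "w * (\<eta> * h) \<le> E * (\<eta> * h)"
        using w(2) L \<eta>(1) h by (auto intro!: mult_right_mono simp: N_def)
      moreover have "E * (\<eta> * h) = \<epsilon> / 2 * h" by (metis \<eta>(2) mult.assoc mult.commute)
      moreover have "w * \<Psi> (X t) - exp (C * t) * \<Psi> (X t) \<le> (\<epsilon> / 2 + w * (C * \<Psi> (X t))) * h"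
        using elim(6) h unfolding w_def[symmetric] by (simp add: field_simps)
      ultimately show ?case
        unfolding g_def N_def[symmetric] w_def[symmetric] by (simp add: algebra_simps)
    qed
  qed
  then show ?thesis by (simp add: g_def)
qed

lemma exp_decay_along_flow:
  fixes \<Theta> :: "(real^'n) set" and \<Psi> :: "real^'n \<Rightarrow> real"
  assumes flow: "flow_of \<Theta> F \<phi>" and lip: "locally_lipschitz_on \<Theta> \<Psi>"
    and \<theta>: "\<theta> \<in> \<Theta>" "\<Psi> \<theta> < \<zeta>" and t: "t \<ge> 0"
    and dini: "\<And>s. 0 \<le> s \<Longrightarrow> exp (C * s) * \<Psi> (\<phi> s \<theta>) < \<zeta> \<Longrightarrow>
      admissible_direction \<Theta> (\<phi> s \<theta>) (F (\<phi> s \<theta>)) \<and>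
      upper_dini \<Psi> (\<phi> s \<theta>) (F (\<phi> s \<theta>)) \<le> ereal (- C * \<Psi> (\<phi> s \<theta>))"
  shows "\<Psi> (\<phi> t \<theta>) \<le> exp (- C * t) * \<Psi> \<theta>"
proof -
  have int: "set_integrable lebesgue {0..s} (\<lambda>\<tau>. F (\<phi> \<tau> \<theta>))"
    and eq: "\<phi> s \<theta> = \<theta> + integral {0..s} (\<lambda>\<tau>. F (\<phi> \<tau> \<theta>))" if "s \<ge> 0" for s
  proof -
    show int: "set_integrable lebesgue {0..s} (\<lambda>\<tau>. F (\<phi> \<tau> \<theta>))"
      using flow \<theta>(1) that unfolding flow_of_def by blast
    have "\<phi> s \<theta> = \<theta> + (LINT \<tau>:{0..s}|lebesgue. F (\<phi> \<tau> \<theta>))"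
      using flow \<theta>(1) that unfolding flow_of_def by blast
    then show "\<phi> s \<theta> = \<theta> + integral {0..s} (\<lambda>\<tau>. F (\<phi> \<tau> \<theta>))"
      by (simp add: set_lebesgue_integral_eq_integral(2)[OF int])
  qed
  have \<phi>0: "\<phi> 0 \<theta> = \<theta>" using eq[of 0] by simp
  have "exp (C * t) * \<Psi> (\<phi> t \<theta>) \<le> \<Psi> (\<phi> 0 \<theta>)"
  proof (rule exp_weighted_decay_along_integral_curve[OF lip t])
    show "(\<lambda>\<tau>. F (\<phi> \<tau> \<theta>)) integrable_on {0..t}"
      using int[OF t] by (rule set_lebesgue_integral_eq_integral(1))
    show "\<phi> s \<theta> \<in> \<Theta>" if "0 \<le> s" for s using flow \<theta>(1) that unfolding flow_of_def by blast
    show "\<phi> s \<theta> = \<phi> 0 \<theta> + integral {0..s} (\<lambda>\<tau>. F (\<phi> \<tau> \<theta>))" if "0 \<le> s" for s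
      using eq[OF that] \<phi>0 by simp
    show "\<Psi> (\<phi> 0 \<theta>) < \<zeta>" using \<theta>(2) \<phi>0 by simp
  qed (use dini in auto)
  then show ?thesis using \<phi>0 by (simp add: exp_minus field_simps)
qed

theorem theorem8:
  fixes \<Theta> :: "(real^'n) set"
    and F :: "real^'n \<Rightarrow> real^'n"
    and \<phi> :: "real \<Rightarrow> real^'n \<Rightarrow> real^'n"
    and \<Psi> :: "real^'n \<Rightarrow> real"
  assumes flow: "flow_of \<Theta> F \<phi>"
    and nonneg: "\<forall>\<theta>\<in>\<Theta>. 0 \<le> \<Psi> \<theta>"
    and lipschitz: "locally_lipschitz_on \<Theta> \<Psi>"
  shows
    "(\<forall>C>0.
        (\<forall>\<theta>\<in>\<Theta>. admissible_direction \<Theta> \<theta> (F \<theta>) \<and> upper_dini \<Psi> \<theta> (F \<theta>) \<le> ereal (- C * \<Psi> \<theta>)) \<longrightarrow>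
        (\<forall>\<theta>\<in>\<Theta>. \<forall>t\<ge>0. \<Psi> (\<phi> t \<theta>) \<le> exp (- C * t) * \<Psi> \<theta>)) \<and>
     (\<forall>C>0. \<forall>\<zeta>>0. \<forall>U. U = {\<theta>\<in>\<Theta>. \<Psi> \<theta> < \<zeta>} \<longrightarrow>
        (\<forall>\<theta>\<in>U. admissible_direction \<Theta> \<theta> (F \<theta>) \<and> upper_dini \<Psi> \<theta> (F \<theta>) \<le> ereal (- C * \<Psi> \<theta>)) \<longrightarrow>
        (\<forall>\<theta>\<in>U. \<forall>t\<ge>0. \<Psi> (\<phi> t \<theta>) \<le> exp (- C * t) * \<Psi> \<theta>)) \<and>
     (\<forall>C>0.
        (\<forall>\<theta>\<in>\<Theta>. admissible_direction \<Theta> \<theta> (F \<theta>) \<and> lower_dini \<Psi> \<theta> (F \<theta>) \<ge> ereal (- C * \<Psi> \<theta>)) \<longrightarrow>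
        (\<forall>\<theta>\<in>\<Theta>. \<forall>t\<ge>0. \<Psi> (\<phi> t \<theta>) \<ge> exp (- C * t) * \<Psi> \<theta>))"
proof -
  have in_\<Theta>: "\<phi> t \<theta> \<in> \<Theta>" if "\<theta> \<in> \<Theta>" "t \<ge> 0" for \<theta> t
    using flow that unfolding flow_of_def by blast
  \<comment> \<open>A time with \<open>exp (C * s) * \<Psi> (\<phi> s \<theta>) < \<zeta>\<close> is one at which the trajectory lies in the sublevel
      set, since the exponential factor is at least 1 and \<open>\<Psi>\<close> is nonnegative.\<close>
  have sublevel: "\<Psi> (\<phi> t \<theta>) \<le> exp (- C * t) * \<Psi> \<theta>"
    if C: "C > 0" and t: "t \<ge> 0" and \<theta>: "\<theta> \<in> \<Theta>" "\<Psi> \<theta> < \<zeta>"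
      and dini: "\<And>x. x \<in> \<Theta> \<Longrightarrow> \<Psi> x < \<zeta> \<Longrightarrow>
        admissible_direction \<Theta> x (F x) \<and> upper_dini \<Psi> x (F x) \<le> ereal (- C * \<Psi> x)"
    for C \<zeta> \<theta> t
  proof (rule exp_decay_along_flow[OF flow lipschitz \<theta> t])
    fix s :: real assume s: "0 \<le> s" "exp (C * s) * \<Psi> (\<phi> s \<theta>) < \<zeta>"
    have "1 * \<Psi> (\<phi> s \<theta>) \<le> exp (C * s) * \<Psi> (\<phi> s \<theta>)"
      using nonneg in_\<Theta>[OF \<theta>(1) s(1)] C s(1) by (intro mult_right_mono) auto
    then show "admissible_direction \<Theta> (\<phi> s \<theta>) (F (\<phi> s \<theta>)) \<and>
      upper_dini \<Psi> (\<phi> s \<theta>) (F (\<phi> s \<theta>)) \<le> ereal (- C * \<Psi> (\<phi> s \<theta>))"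
      using s(2) in_\<Theta>[OF \<theta>(1) s(1)] by (intro dini) auto
  qed
  \<comment> \<open>For \<open>- \<Psi>\<close> the Dini inequality holds on all of \<open>\<Theta>\<close>, so any threshold above the initial value
      will do.\<close>
  have lower: "exp (- C * t) * \<Psi> \<theta> \<le> \<Psi> (\<phi> t \<theta>)"
    if t: "t \<ge> 0" and \<theta>: "\<theta> \<in> \<Theta>"
      and dini: "\<And>x. x \<in> \<Theta> \<Longrightarrow>
        admissible_direction \<Theta> x (F x) \<and> lower_dini \<Psi> x (F x) \<ge> ereal (- C * \<Psi> x)"
    for C \<theta> t
  proof -
    have "locally_lipschitz_on \<Theta> (\<lambda>x. - \<Psi> x)"
      using lipschitz by (simp add: locally_lipschitz_on_def)
    then have "- \<Psi> (\<phi> t \<theta>) \<le> exp (- C * t) * - \<Psi> \<theta>"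
    proof (rule exp_decay_along_flow[OF flow _ \<theta> _ t, where \<zeta> = "- \<Psi> \<theta> + 1"])
      fix s :: real assume "0 \<le> s"
      then show "admissible_direction \<Theta> (\<phi> s \<theta>) (F (\<phi> s \<theta>)) \<and>
        upper_dini (\<lambda>x. - \<Psi> x) (\<phi> s \<theta>) (F (\<phi> s \<theta>)) \<le> ereal (- C * - \<Psi> (\<phi> s \<theta>))"
        using dini[OF in_\<Theta>[OF \<theta>]] by (simp add: upper_dini_uminus ereal_uminus_le_reorder)
    qed simp
    then show ?thesis by simp
  qed
  show ?thesis
  proof (intro conjI allI impI ballI)
    fix C :: real and \<theta> and t :: real
    assume "C > 0" "\<theta> \<in> \<Theta>" "0 \<le> t"
      and "\<forall>\<theta>\<in>\<Theta>. admissible_direction \<Theta> \<theta> (F \<theta>) \<and> upper_dini \<Psi> \<theta> (F \<theta>) \<le> ereal (- C * \<Psi> \<theta>)"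
    then show "\<Psi> (\<phi> t \<theta>) \<le> exp (- C * t) * \<Psi> \<theta>"
      by (intro sublevel[where \<zeta> = "\<Psi> \<theta> + 1"]) auto
  next
    fix C \<zeta> :: real and U \<theta> and t :: real
    assume "C > 0" "\<theta> \<in> U" "0 \<le> t" "U = {\<theta>\<in>\<Theta>. \<Psi> \<theta> < \<zeta>}"
      and "\<forall>\<theta>\<in>U. admissible_direction \<Theta> \<theta> (F \<theta>) \<and> upper_dini \<Psi> \<theta> (F \<theta>) \<le> ereal (- C * \<Psi> \<theta>)"
    then show "\<Psi> (\<phi> t \<theta>) \<le> exp (- C * t) * \<Psi> \<theta>"
      by (intro sublevel[where \<zeta> = \<zeta>]) auto
  next
    fix C :: real and \<theta> and t :: real
    assume "\<theta> \<in> \<Theta>" "0 \<le> t"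
      and "\<forall>\<theta>\<in>\<Theta>. admissible_direction \<Theta> \<theta> (F \<theta>) \<and> lower_dini \<Psi> \<theta> (F \<theta>) \<ge> ereal (- C * \<Psi> \<theta>)"
    then show "\<Psi> (\<phi> t \<theta>) \<ge> exp (- C * t) * \<Psi> \<theta>"
      by (intro lower) auto
  qed
qed

end
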